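(* Let $C\subseteq\mathbb{R}^2$ be the interior of a strictly convex body. For every finite set of points $S\subseteq\mathbb{R}^2$ in general position relative to $C$ and every integer $k\ge 2$, $$a_k(S)\le 4\bigl(e_{k-2}(S)+e_{k-1}(S)+e_k(S)\bigr),$$ where $a_k(S)$ is the number of $T_C$-$k$-sets of $S$ and $e_j(S)$ is the number of $T_C$-$j$-edges of $S$.
   Context: A convex body is a compact convex set with non-empty interior; a set $K$ is strictly convex if for all $x\ne y$ in $K$ and $\lambda\in(0,1)$, $\lambda x+(1-\lambda)y\in\operatorname{int}K$. For $C$ the interior of a strictly convex body in $\mathbb{R}^2$, $T_C=\{x+C: x\in\mathbb{R}^2\}$ is the family of translations of $C$; its elements are called ranges (they are open sets, so a point on the boundary of a range is not in the range). A $T_C$-$k$-set of a finite set $S\subseteq\mathbb{R}^2$ is a subset $T\subseteq S$ of $k$ points such that for some $Q\in T_C$ we have $S\cap\operatorname{bd}Q=\emptyset$ and $T=S\cap Q$. A set of points is in general position relative to $C$ if no three of its (distinct) points lie on the boundary of a common range in $T_C$. Let $V\subseteq(\mathbb{R}^2)^2$ be the set of ordered pairs $(p,q)$ of distinct points such that $p,q\in\operatorname{bd}Q$ for some $Q\in T_C$. For each $(p,q)\in V$ there are one or two ranges having both $p$ and $q$ on their boundary. Define $\mathcal{C}(p,q)\in T_C$ as follows: if there is exactly one such range, $\mathcal{C}(p,q)$ is that range; if there are two such ranges $C_1,C_2$, $\mathcal{C}(p,q)$ is the unique one among them maximizing $\operatorname{area}(C_i\cap \operatorname{aff}(p,q)^+)$,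 where $\operatorname{aff}(p,q)^+=\{r: -(q-p)_x(r-p)_y+(q-p)_y(r-p)_x>0\}$ (subscripts $x,y$ denote coordinates). For a finite set $S$ in general position relative to $C$, a $T_C$-$k$-edge of $S$ is an ordered pair $(p,q)\in V$ with $p,q\in S$, $p\ne q$, such that $\mathcal{C}(p,q)$ contains exactly $k$ points of $S$. *)

theory Defs
  imports "HOL-Analysis.Analysis"
begin

definition convex_body :: "'a::euclidean_space set \<Rightarrow> bool" where
  "convex_body K \<longleftrightarrow> compact K \<and> convex K \<and> interior K \<noteq> {}"

definition strictly_convex :: "'a::euclidean_space set \<Rightarrow> bool" where
  "strictly_convex K \<longleftrightarrow>
     (\<forall>x\<in>K. \<forall>y\<in>K. x \<noteq> y \<longrightarrow>
        (\<forall>t\<in>{0<..<1::real}. t *\<^sub>R x + (1 - t) *\<^sub>R y \<in> interior K))"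

definition translates :: "(real^2) set \<Rightarrow> (real^2) set set" where
  "translates C = {(+) x ` C | x. x \<in> UNIV}"

definition k_sets :: "(real^2) set \<Rightarrow> nat \<Rightarrow> (real^2) set \<Rightarrow> (real^2) set set" where
  "k_sets C k S =
     {T. T \<subseteq> S \<and> card T = k \<and> (\<exists>Q\<in>translates C. S \<inter> frontier Q = {} \<and> T = S \<inter> Q)}"

definition general_position :: "(real^2) set \<Rightarrow> (real^2) set \<Rightarrow> bool" where
  "general_position C S \<longleftrightarrow>
     (\<forall>p\<in>S. \<forall>q\<in>S. \<forall>r\<in>S. p \<noteq> q \<and> q \<noteq> r \<and> p \<noteq> r \<longrightarrow>
        \<not> (\<exists>Q\<in>translates C. p \<in> frontier Q \<and> q \<in> frontier Q \<and> r \<in> frontier Q))"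

definition ranges_through :: "(real^2) set \<Rightarrow> real^2 \<Rightarrow> real^2 \<Rightarrow> (real^2) set set" where
  "ranges_through C p q = {Q \<in> translates C. p \<in> frontier Q \<and> q \<in> frontier Q}"

definition cocircular_pairs :: "(real^2) set \<Rightarrow> ((real^2) \<times> (real^2)) set" where
  "cocircular_pairs C = {(p, q). p \<noteq> q \<and> ranges_through C p q \<noteq> {}}"

definition aff_plus :: "real^2 \<Rightarrow> real^2 \<Rightarrow> (real^2) set" where
  "aff_plus p q = {r. - ((q - p) $ 1) * (r - p) $ 2 + (q - p) $ 2 * (r - p) $ 1 > 0}"

text \<open>
  For \<open>(p, q) \<in> cocircular_pairs C\<close> there are one or two ranges through \<open>p\<close> and \<open>q\<close>.
  In the latter case the maximizer is unique: the two regions \<open>Q \<inter> aff_plus p q\<close> are, up to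
  translation, caps of \<open>C\<close> cut off on the same side by two different parallel chords, so one
  is properly contained in the other. For all other pairs the value is irrelevant.
\<close>

definition chosen_range :: "(real^2) set \<Rightarrow> real^2 \<Rightarrow> real^2 \<Rightarrow> (real^2) set" where
  "chosen_range C p q =
     (if \<exists>!Q. Q \<in> ranges_through C p q
      then THE Q. Q \<in> ranges_through C p q
      else THE Q. is_arg_max (\<lambda>Q. measure lebesgue (Q \<inter> aff_plus p q))
                             (\<lambda>Q. Q \<in> ranges_through C p q) Q)"

definition k_edges :: "(real^2) set \<Rightarrow> nat \<Rightarrow> (real^2) set \<Rightarrow> ((real^2) \<times> (real^2)) set" where
  "k_edges C k S =
     {(p, q). (p, q) \<in> cocircular_pairs C \<and> p \<in> S \<and> q \<in> S \<and> p \<noteq> q \<and>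
              card (S \<inter> chosen_range C p q) = k}"

end

theory Submission
  imports Defs
begin

text \<open>
  A range is given by its position \<open>x\<close>: it is \<open>x + C\<close>, and a point \<open>p\<close> lies in it iff \<open>p - x \<in> C\<close>.
  In the plane of positions, the translates \<open>p - C\<close> for \<open>p \<in> S\<close> form an arrangement. A \<open>k\<close>-set
  belongs to a cell covered exactly \<open>k\<close> times, and an edge belongs to a vertex, that is, to a
  position whose range has two points of \<open>S\<close> on its boundary. At most four subsets of \<open>S\<close> occur
  in the cells around one vertex: they differ only in which of the two boundary points they contain.
  So the bound follows once every \<open>k\<close>-set is shown to occur around some vertex, and every vertex
  is shown to be recorded by some edge. The two boundary points account for at most two of the
  \<open>k\<close> points, hence the depths \<open>k - 2\<close>, \<open>k - 1\<close> and \<open>k\<close>.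

  Existence of a vertex (\<open>exists_two_frontier_points\<close>) is a connectedness argument. Let \<open>F\<close> be the
  set of positions \<open>x\<close> for which \<open>x + K\<close> contains \<open>T\<close> and \<open>x + C\<close> misses \<open>S - T\<close>. If \<open>F\<close> contained
  no vertex, then \<open>F\<close> would meet each curve \<open>p - bd K\<close> in a relatively clopen set, hence in nothing
  or in the whole curve. In the second case a translate of \<open>K\<close> would lie in a different translate,
  because \<open>T\<close> has a point other than \<open>p\<close>; this is where \<open>k \<ge> 2\<close> enters. So \<open>F\<close> meets no
  curve at all, which makes it open as well as closed, although it is nonempty and bounded.

  That a vertex is recorded by an edge (\<open>range_chosen_for_some_order\<close>) concerns the ranges through
  two given points \<open>p\<close> and \<open>q\<close>. They correspond to the chords of \<open>K\<close> that are translates of the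
  segment from \<open>p\<close> to \<open>q\<close>. By strict convexity no two of these chords are collinear and none lies
  between two others. Therefore each one is either strictly below or strictly above all others,
  measured across their common direction. The caps cut off on a fixed side of
  parallel chords are nested, so the lowest chord has the largest cap above it and the highest chord
  has the largest cap below it: one is chosen for \<open>(p, q)\<close>, the other for \<open>(q, p)\<close>.
\<close>

section \<open>Pulling translates back to one body\<close>

lemma frontier_interior_convex_body:
  fixes K :: "'a::euclidean_space set"
  assumes "convex_body K"
  shows "frontier (interior K) = frontier K"
  using assms convex_closure_interior[of K]
  by (auto simp: convex_body_def frontier_def)

lemma closed_mem_iff_interior_or_frontier:
  "closed K \<Longrightarrow> a \<in> K \<longleftrightarrow> a \<in> interior K \<or> a \<in> frontier K"
  using interior_subset[of K] by (auto simp: frontier_def)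

lemma interior_not_frontier: "a \<in> interior K \<Longrightarrow> a \<notin> frontier K"
  by (simp add: frontier_def)

lemma mem_translation_iff: "p \<in> (+) x ` A \<longleftrightarrow> p - x \<in> A" for p x :: "'a::ab_group_add"
  by (auto simp: image_iff algebra_simps intro!: bexI[of _ "p - x"])

lemma mem_frontier_translation_iff:
  fixes K :: "'a::euclidean_space set"
  assumes "convex_body K"
  shows "p \<in> frontier ((+) x ` interior K) \<longleftrightarrow> p - x \<in> frontier K"
  by (simp add: frontier_translation mem_translation_iff frontier_interior_convex_body[OF assms])

section \<open>Positions with two points on the boundary\<close>

text \<open>
  In dimension one the boundary is a pair of points; from dimension two on it is a topological sphere.
\<close>

lemma connected_frontier_convex_body:
  fixes K :: "'a::euclidean_space set"
  assumes "convex_body K" and "2 \<le> DIM('a)"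
  shows "connected (frontier K)"
proof -
  have "convex K" "bounded K" and ne: "interior K \<noteq> {}"
    using assms by (auto simp: convex_body_def compact_imp_bounded)
  moreover have "aff_dim K \<noteq> 1"
    using aff_dim_nonempty_interior[OF ne] assms(2) by simp
  ultimately have "connected (rel_frontier K)"
    by (intro connected_sphere_gen)
  then show ?thesis
    by (simp add: rel_frontier_nonempty_interior[OF ne])
qed

text \<open>
  A convex body is the convex hull of its boundary, so the hypothesis moves all of \<open>K\<close> into itself.
  The largest value of the functional \<open>a \<mapsto> d \<bullet> a\<close> on \<open>K\<close> would then be exceeded by \<open>d \<bullet> d\<close>.
\<close>

lemma translated_frontier_subset_imp_zero:
  fixes K :: "'a::euclidean_space set"
  assumes "convex_body K" and sub: "\<And>a. a \<in> frontier K \<Longrightarrow> a + d \<in> K"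
  shows "d = 0"
proof -
  have K: "compact K" "convex K" "K \<noteq> {}"
    using assms(1) interior_subset by (auto simp: convex_body_def)
  have "{a. a + d \<in> K} = (+) (- d) ` K"
    by (simp only: set_eq_iff mem_translation_iff diff_minus_eq_add mem_Collect_eq simp_thms)
  then have "convex {a. a + d \<in> K}"
    using convex_translation[OF K(2)] by simp
  with sub have "convex hull (frontier K) \<subseteq> {a. a + d \<in> K}"
    by (intro hull_minimal) auto
  then have shift: "a + d \<in> K" if "a \<in> K" for a
    using that unfolding Krein_Milman_frontier[OF K(2,1), symmetric] by blast
  have "continuous_on K (\<lambda>a. d \<bullet> a)"
    by (intro continuous_intros)
  then obtain a where a: "a \<in> K" "\<And>b. b \<in> K \<Longrightarrow> d \<bullet> b \<le> d \<bullet> a"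
    using continuous_attains_sup[OF K(1,3)] by blast
  from a(2)[OF shift[OF a(1)]] have "d \<bullet> d \<le> 0"
    by (simp add: inner_add_right)
  then show "d = 0"
    by (metis inner_eq_zero_iff inner_ge_zero order_antisym)
qed

text \<open>
  Moving a range from its position \<open>x0\<close>, as long as it loses no point of \<open>T\<close> and swallows no other
  point of \<open>S\<close>, it can be brought to a position with two points of \<open>S\<close> on its boundary. Points are
  allowed to touch the boundary, so that the set \<open>F\<close> of admissible positions is closed.
\<close>

lemma exists_two_frontier_points:
  fixes K S T :: "'a::euclidean_space set"
  assumes K: "convex_body K" and dim: "2 \<le> DIM('a)"
    and fin: "finite S" and TS: "T \<subseteq> S" and card: "card T \<ge> 2"
    and x0: "\<And>t. t \<in> T \<Longrightarrow> t - x0 \<in> K" "\<And>s. s \<in> S - T \<Longrightarrow> s - x0 \<notin> interior K"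
  obtains p q x where "p \<in> S" "q \<in> S" "p \<noteq> q" "p - x \<in> frontier K" "q - x \<in> frontier K"
    "\<forall>t\<in>T. t - x \<in> K" "\<forall>s\<in>S - T. s - x \<notin> interior K"
proof (rule ccontr)
  note found = that
  assume contra: "\<not> thesis"
  define F where "F = {x. (\<forall>t\<in>T. t - x \<in> K) \<and> (\<forall>s\<in>S-T. s - x \<notin> interior K)}"
  \<comment> \<open>The open conditions that the points other than \<open>p\<close> impose; on the curve of \<open>p\<close> they describe
    \<open>F\<close>, because there \<open>p\<close> has used up the only boundary point that \<open>F\<close> permits.\<close>
  define W where
    "W p = {x. (\<forall>t\<in>T-{p}. t - x \<in> interior K) \<and> (\<forall>s\<in>S-T-{p}. s - x \<notin> K)}" for p
  define curve where "curve p = {x. p - x \<in> frontier K}" for p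
  have cK: "closed K" "bounded K"
    using K by (auto simp: convex_body_def compact_imp_closed compact_imp_bounded)
  note split = closed_mem_iff_interior_or_frontier[OF cK(1)] interior_not_frontier[of _ K]
  have unique: "p = q" if "x \<in> F" "p \<in> S" "q \<in> S" "p - x \<in> frontier K" "q - x \<in> frontier K" for x p q
  proof (rule ccontr)
    assume "p \<noteq> q"
    have "\<forall>t\<in>T. t - x \<in> K" "\<forall>s\<in>S - T. s - x \<notin> interior K"
      using that(1) by (simp_all add: F_def)
    with found[OF that(2,3) \<open>p \<noteq> q\<close> that(4,5)] contra show False by simp
  qed
  have finT: "finite T" using fin TS finite_subset by auto
  have F_Inter: "F = (\<Inter>t\<in>T. (\<lambda>x. t - x) -` K) \<inter> (\<Inter>s\<in>S-T. (\<lambda>x. s - x) -` (- interior K))"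
    by (auto simp: F_def)
  have closedF: "closed F"
    unfolding F_Inter using cK(1)
    by (intro closed_Int closed_INT ballI continuous_closed_vimage continuous_intros) auto
  have W_Inter: "W p = (\<Inter>t\<in>T-{p}. (\<lambda>x. t - x) -` interior K) \<inter> (\<Inter>s\<in>S-T-{p}. (\<lambda>x. s - x) -` (- K))" for p
    by (auto simp: W_def)
  have openW: "open (W p)" for p
    unfolding W_Inter using cK(1) fin finT
    by (intro open_Int open_INT ballI continuous_open_vimage continuous_intros) auto
  have no_curve: "F \<inter> curve p = {}" if "p \<in> S" for p
  proof (rule ccontr)
    assume ne: "F \<inter> curve p \<noteq> {}"
    have "curve p = (\<lambda>a. p - a) ` frontier K"
    proof (intro equalityI subsetI)
      fix x assume "x \<in> curve p"
      then show "x \<in> (\<lambda>a. p - a) ` frontier K"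
        by (intro image_eqI[of _ _ "p - x"]) (simp_all add: curve_def)
    qed (auto simp: curve_def)
    moreover have "connected ((\<lambda>a. p - a) ` frontier K)"
      by (intro connected_continuous_image connected_frontier_convex_body K dim continuous_intros)
    ultimately have conn: "connected (curve p)" by simp
    have eq: "curve p \<inter> F = curve p \<inter> W p"
    proof (intro equalityI subsetI)
      fix x assume x: "x \<in> curve p \<inter> F"
      then have "s - x \<notin> frontier K" if "s \<in> S" "s \<noteq> p" for s
        using unique[of x p s] that \<open>p \<in> S\<close> by (auto simp: curve_def)
      with x show "x \<in> curve p \<inter> W p"
        using TS split(1) unfolding F_def W_def by blast
    next
      fix x assume "x \<in> curve p \<inter> W p"
      then show "x \<in> curve p \<inter> F"
        using split unfolding F_def W_def curve_def by blast
    qed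
    have "openin (top_of_set (curve p)) (curve p \<inter> F)"
      unfolding eq by (intro openin_open_Int openW)
    moreover have "closedin (top_of_set (curve p)) (curve p \<inter> F)"
      by (intro closedin_closed_Int closedF)
    ultimately have "curve p \<inter> F = {} \<or> curve p \<inter> F = curve p"
      using conn unfolding connected_clopen by blast
    with ne have all: "curve p \<subseteq> F" by blast
    obtain t where t: "t \<in> T" "t \<noteq> p"
      using card finT by (metis One_nat_def card_le_Suc0_iff_eq not_less_eq_eq numeral_2_eq_2)
    have "t - p = 0"
    proof (rule translated_frontier_subset_imp_zero[OF K])
      fix a assume "a \<in> frontier K"
      then have "p - a \<in> F" using all by (auto simp: curve_def)
      with t(1) show "a + (t - p) \<in> K" by (auto simp: F_def algebra_simps)
    qed
    with t(2) show False by simp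
  qed
  \<comment> \<open>As no point of \<open>S\<close> ever touches the boundary, all defining conditions of \<open>F\<close> are strict.\<close>
  have "F = {x. (\<forall>t\<in>T. t - x \<in> interior K) \<and> (\<forall>s\<in>S-T. s - x \<notin> K)}"
  proof (intro equalityI subsetI)
    fix x assume x: "x \<in> F"
    then have "s - x \<notin> frontier K" if "s \<in> S" for s
      using no_curve[OF that] by (auto simp: curve_def)
    with x show "x \<in> {x. (\<forall>t\<in>T. t - x \<in> interior K) \<and> (\<forall>s\<in>S-T. s - x \<notin> K)}"
      using TS split(1) unfolding F_def by blast
  qed (use split(1) in \<open>auto simp: F_def\<close>)
  also have "\<dots> = (\<Inter>t\<in>T. (\<lambda>x. t - x) -` interior K) \<inter> (\<Inter>s\<in>S-T. (\<lambda>x. s - x) -` (- K))"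
    by auto
  also have "open \<dots>"
    using cK(1) fin finT
    by (intro open_Int open_INT ballI continuous_open_vimage continuous_intros) auto
  finally have "open F" .
  moreover have "x0 \<in> F" using x0 by (auto simp: F_def)
  ultimately have "F = UNIV"
    using closedF clopen by blast
  moreover have "T \<noteq> {}" using card by auto
  then obtain t where "t \<in> T" by blast
  ultimately have "t - (t - a) \<in> K" for a
    unfolding F_def by blast
  then have "K = UNIV"
    by (simp add: set_eq_iff)
  with cK(2) show False
    using not_bounded_UNIV[where 'a = 'a] by simp
qed

section \<open>Parallel chords of equal length\<close>

text \<open>
  The range \<open>x + C\<close> has both \<open>p\<close> and \<open>q\<close> on its boundary iff \<open>p - x\<close> starts a chord with
  vector \<open>q - p\<close>.
\<close>

definition chord_starts :: "'a::euclidean_space set \<Rightarrow> 'a \<Rightarrow> 'a set" where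
  "chord_starts K v = {a. a \<in> frontier K \<and> a + v \<in> frontier K}"

text \<open>
  If a point of \<open>K\<close> lay on the chord's line beyond one of the end points, that end point would be strictly
  between two points of \<open>K\<close> and thus in the interior.
\<close>

lemma chord_parameter_bounds:
  fixes K :: "'a::euclidean_space set"
  assumes sc: "strictly_convex K" and cl: "closed K"
    and v: "v \<noteq> 0" and b: "b \<in> chord_starts K v" and c: "b + \<tau> *\<^sub>R v \<in> K"
  shows "0 \<le> \<tau>" "\<tau> \<le> 1"
proof -
  have bK: "b \<in> K" "b + v \<in> K" "b \<notin> interior K" "b + v \<notin> interior K"
    using b cl by (auto simp: chord_starts_def frontier_def)
  show "0 \<le> \<tau>"
  proof (rule ccontr)
    assume "\<not> 0 \<le> \<tau>"
    \<comment> \<open>The weight for which the combination of \<open>b + \<tau> v\<close> and \<open>b + v\<close> is \<open>b\<close>.\<close>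
    then have t: "1 / (1 - \<tau>) \<in> {0<..<1}" by (simp add: field_simps)
    have "b + \<tau> *\<^sub>R v \<noteq> b + v"
      using \<open>\<not> 0 \<le> \<tau>\<close> v scaleR_right_imp_eq[of v \<tau> 1] by auto
    then have "(1 / (1 - \<tau>)) *\<^sub>R (b + \<tau> *\<^sub>R v) + (1 - 1 / (1 - \<tau>)) *\<^sub>R (b + v) \<in> interior K"
      using sc c bK(2) t unfolding strictly_convex_def by blast
    also have "(1 / (1 - \<tau>)) *\<^sub>R (b + \<tau> *\<^sub>R v) + (1 - 1 / (1 - \<tau>)) *\<^sub>R (b + v)
        = b + (\<tau> / (1 - \<tau>) + 1 - 1 / (1 - \<tau>)) *\<^sub>R v"
      by (simp add: algebra_simps)
    also have "\<tau> / (1 - \<tau>) + 1 - 1 / (1 - \<tau>) = 0"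
      using \<open>\<not> 0 \<le> \<tau>\<close> by (simp add: field_simps)
    finally show False using bK(3) by simp
  qed
  show "\<tau> \<le> 1"
  proof (rule ccontr)
    assume "\<not> \<tau> \<le> 1"
    then have t: "1 / \<tau> \<in> {0<..<1}" by (simp add: field_simps)
    have "b + \<tau> *\<^sub>R v \<noteq> b" using \<open>\<not> \<tau> \<le> 1\<close> v by auto
    then have "(1 / \<tau>) *\<^sub>R (b + \<tau> *\<^sub>R v) + (1 - 1 / \<tau>) *\<^sub>R b \<in> interior K"
      using sc c bK(1) t unfolding strictly_convex_def by blast
    also have "(1 / \<tau>) *\<^sub>R (b + \<tau> *\<^sub>R v) + (1 - 1 / \<tau>) *\<^sub>R b = b + v"
      using \<open>\<not> \<tau> \<le> 1\<close> by (simp add: algebra_simps)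
    finally show False using bK(4) by simp
  qed
qed

text \<open>
  A segment on the chord's line that lies in \<open>K\<close> is contained in the chord; if it has the same
  length, it is the chord.
\<close>

lemma chord_not_movable_along_itself:
  fixes K :: "'a::euclidean_space set"
  assumes "strictly_convex K" "closed K" "v \<noteq> 0" "b \<in> chord_starts K v"
    and "b + \<tau> *\<^sub>R v \<in> K" and "(b + \<tau> *\<^sub>R v) + v \<in> K"
  shows "\<tau> = 0"
proof -
  have "b + (\<tau> + 1) *\<^sub>R v \<in> K"
    using assms(6) by (simp add: algebra_simps)
  from chord_parameter_bounds[OF assms(1-4) this] chord_parameter_bounds[OF assms(1-5)]
  show ?thesis by simp
qed

text \<open>
  The vector \<open>v\<close> turned clockwise by a right angle. With this orientation \<open>aff_plus p q\<close> is the open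
  half-plane above the line through \<open>p\<close> and \<open>q\<close>, where the height of \<open>r\<close> is \<open>perp (q - p) \<bullet> r\<close>.
\<close>

definition perp :: "real^2 \<Rightarrow> real^2" where
  "perp v = vector [v $ 2, - v $ 1]"

lemma inner_perp: "perp v \<bullet> r = v $ 2 * r $ 1 - v $ 1 * r $ 2"
  by (simp add: perp_def inner_vec_def sum_2)

lemma perp_uminus: "perp (- v) = - perp v"
  by (simp add: perp_def vec_eq_iff forall_2)

lemma inner_perp_self [simp]: "perp v \<bullet> v = 0"
  by (simp add: inner_perp)

lemma parallel_if_inner_perp_eq_0:
  assumes "v \<noteq> 0" and "perp v \<bullet> w = 0"
  obtains \<tau> where "w = \<tau> *\<^sub>R v"
proof (cases "v $ 1 = 0")
  case True
  then have "v $ 2 \<noteq> 0" using assms(1) by (auto simp: vec_eq_iff forall_2)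
  then have "w = (w $ 2 / v $ 2) *\<^sub>R v"
    using assms(2) True by (simp add: vec_eq_iff forall_2 inner_perp)
  then show ?thesis by (rule that)
next
  case False
  then have "w = (w $ 1 / v $ 1) *\<^sub>R v"
    using assms(2) by (simp add: vec_eq_iff forall_2 inner_perp field_simps)
  then show ?thesis by (rule that)
qed

lemma aff_plus_eq: "aff_plus p q = {r. perp (q - p) \<bullet> (r - p) > 0}"
  by (simp add: aff_plus_def inner_perp algebra_simps)

lemma chord_heights_distinct:
  assumes "strictly_convex K" "closed K" "v \<noteq> 0"
    and "a \<in> chord_starts K v" "b \<in> chord_starts K v" and eq: "perp v \<bullet> a = perp v \<bullet> b"
  shows "a = b"
proof -
  have "perp v \<bullet> (a - b) = 0" using eq by (simp add: inner_diff_right)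
  then obtain \<tau> where "a - b = \<tau> *\<^sub>R v"
    using parallel_if_inner_perp_eq_0 assms(3) by blast
  then have a: "a = b + \<tau> *\<^sub>R v" by (simp add: algebra_simps)
  have "a \<in> K" "a + v \<in> K"
    using assms(2,4) by (auto simp: chord_starts_def frontier_def)
  then have "\<tau> = 0"
    using chord_not_movable_along_itself[OF assms(1-3,5)] a by simp
  with a show ?thesis by simp
qed

text \<open>
  By convexity the chords starting in \<open>a\<close> and \<open>c\<close> span a parallelogram in \<open>K\<close>. At the height of
  \<open>b\<close> it contains a segment with vector \<open>v\<close> whose end points are interior. That segment cannot
  differ from the chord at \<open>b\<close>, whose end points are on the boundary.
\<close>

lemma no_chord_between_chords:
  assumes "strictly_convex K" "closed K" "v \<noteq> 0"
    and a: "a \<in> chord_starts K v" and b: "b \<in> chord_starts K v" and c: "c \<in> chord_starts K v"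
    and lt: "perp v \<bullet> a < perp v \<bullet> b" "perp v \<bullet> b < perp v \<bullet> c"
  shows False
proof -
  define h where "h = (\<lambda>r. perp v \<bullet> r)"
  \<comment> \<open>\<open>t\<close> is chosen so that the point \<open>d\<close> between \<open>a\<close> and \<open>c\<close> has the height of \<open>b\<close>.\<close>
  define t where "t = (h c - h b) / (h c - h a)"
  define d where "d = t *\<^sub>R a + (1 - t) *\<^sub>R c"
  have t: "t \<in> {0<..<1}" using lt by (simp add: t_def h_def field_simps)
  have K: "a \<in> K" "c \<in> K" "a + v \<in> K" "c + v \<in> K"
    using assms(2) a c by (auto simp: chord_starts_def frontier_def)
  have "a \<noteq> c" using lt by auto
  then have d: "d \<in> interior K"
    using assms(1) K t unfolding strictly_convex_def d_def by blast
  have "t *\<^sub>R (a + v) + (1 - t) *\<^sub>R (c + v) \<in> interior K"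
    using assms(1) K t \<open>a \<noteq> c\<close> unfolding strictly_convex_def by (metis add_right_cancel)
  then have dv: "d + v \<in> interior K"
    by (simp add: d_def algebra_simps)
  have "h d = h c - t * (h c - h a)"
    by (simp add: d_def h_def inner_add_right algebra_simps)
  also have "\<dots> = h b"
    using lt by (simp add: t_def h_def)
  finally have "perp v \<bullet> (d - b) = 0" by (simp add: h_def inner_diff_right)
  then obtain \<tau> where "d - b = \<tau> *\<^sub>R v"
    using parallel_if_inner_perp_eq_0 assms(3) by blast
  then have db: "d = b + \<tau> *\<^sub>R v" by (simp add: algebra_simps)
  then have "\<tau> = 0"
    using chord_not_movable_along_itself[OF assms(1-3) b] d dv interior_subset[of K] by blast
  with db d b show False
    by (simp add: chord_starts_def frontier_def)
qed

section \<open>Every range through two points is chosen for one of the two orders\<close>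

text \<open>
  The caps are nested, and the open slab between the two cutting hyperplanes meets the interior of
  \<open>K\<close>, for instance in the midpoint of \<open>a\<close> and \<open>b\<close>.
\<close>

lemma cap_measure_strict_mono:
  fixes K :: "'a::euclidean_space set"
  assumes sc: "strictly_convex K" and bd: "bounded K"
    and ab: "a \<in> K" "b \<in> K" and lt: "u \<bullet> a < u \<bullet> b"
  shows "measure lebesgue (interior K \<inter> {z. u \<bullet> b < u \<bullet> z})
       < measure lebesgue (interior K \<inter> {z. u \<bullet> a < u \<bullet> z})"
    (is "measure _ ?B < measure _ ?A")
proof -
  define M where "M = interior K \<inter> {z. u \<bullet> a < u \<bullet> z} \<inter> {z. u \<bullet> z < u \<bullet> b}"
  have bi: "bounded (interior K)" using bd bounded_subset interior_subset by blast
  have op: "open ?A" "open ?B" "open M"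
    unfolding M_def by (intro open_Int open_interior open_halfspace_gt open_halfspace_lt)+
  have meas: "?A \<in> lmeasurable" "?B \<in> lmeasurable" "M \<in> lmeasurable"
    using op bi by (auto intro!: lmeasurable_open intro: bounded_subset simp: M_def)
  define m where "m = (1/2) *\<^sub>R a + (1 - 1/2) *\<^sub>R b"
  have "a \<noteq> b" using lt by auto
  moreover have "(1/2::real) \<in> {0<..<1}" by simp
  ultimately have "m \<in> interior K"
    using sc ab unfolding strictly_convex_def m_def by blast
  then have "m \<in> M" using lt by (simp add: M_def m_def inner_add_right)
  then have "\<not> negligible M" using open_not_negligible[OF op(3)] by blast
  then have "0 < measure lebesgue M"
    using meas(3) by (simp add: negligible_iff_measure0 zero_less_measure_iff)
  also have "measure lebesgue M \<le> measure lebesgue (?A - ?B)"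
    using meas by (intro measure_mono_fmeasurable) (auto simp: M_def)
  also have "\<dots> = measure lebesgue ?A - measure lebesgue ?B"
    using meas lt by (intro measurable_measure_Diff) auto
  finally show ?thesis by simp
qed

lemma ranges_through_eq:
  assumes "convex_body K"
  shows "ranges_through (interior K) p q = {(+) x ` interior K | x. p - x \<in> chord_starts K (q - p)}"
  by (auto simp: ranges_through_def translates_def chord_starts_def
      mem_frontier_translation_iff[OF assms])

text \<open>
  The hypothesis \<open>low\<close> says that the chord of the range is below all others, so its cap on the
  upper side, which is the side \<open>aff_plus p q\<close>, is strictly largest.
\<close>

lemma chosen_range_eqI:
  assumes K: "convex_body K" "strictly_convex K"
    and x: "p - x \<in> chord_starts K (q - p)"
    and low: "\<And>b. b \<in> chord_starts K (q - p) \<Longrightarrow> b \<noteq> p - x \<Longrightarrow>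
      perp (q - p) \<bullet> (p - x) < perp (q - p) \<bullet> b"
  shows "chosen_range (interior K) p q = (+) x ` interior K"
proof -
  let ?Q = "(+) x ` interior K" and ?R = "ranges_through (interior K) p q"
  define f where "f = (\<lambda>Q. measure lebesgue (Q \<inter> aff_plus p q))"
  have cK: "closed K" "bounded K"
    using K by (auto simp: convex_body_def compact_imp_closed compact_imp_bounded)
  have Q: "?Q \<in> ?R" using x by (auto simp: ranges_through_eq[OF K(1)])
  have f: "f ((+) y ` interior K)
      = measure lebesgue (interior K \<inter> {z. perp (q - p) \<bullet> (p - y) < perp (q - p) \<bullet> z})" for y
  proof -
    have "(+) y ` interior K \<inter> aff_plus p q
        = (+) y ` (interior K \<inter> {z. perp (q - p) \<bullet> (p - y) < perp (q - p) \<bullet> z})"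
      by (auto simp: aff_plus_eq inner_add_right inner_diff_right mem_translation_iff)
    then show ?thesis by (simp add: f_def measure_translation)
  qed
  have less: "f Q' < f ?Q" if Q': "Q' \<in> ?R" "Q' \<noteq> ?Q" for Q'
  proof -
    obtain y where y: "Q' = (+) y ` interior K" "p - y \<in> chord_starts K (q - p)"
      using Q'(1) by (auto simp: ranges_through_eq[OF K(1)])
    with Q'(2) have "p - y \<noteq> p - x" by auto
    from low[OF y(2) this] x y(2) cK K(2) show ?thesis
      unfolding y(1) f by (intro cap_measure_strict_mono) (auto simp: chord_starts_def frontier_def)
  qed
  show ?thesis
  proof (cases "\<exists>!Q. Q \<in> ?R")
    case True
    then have "(THE Q. Q \<in> ?R) = ?Q" using Q by (rule the1_equality)
    with True show ?thesis by (simp add: chosen_range_def)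
  next
    case False
    have "(THE Q. is_arg_max f (\<lambda>Q. Q \<in> ?R) Q) = ?Q"
    proof (rule the_equality)
      show "is_arg_max f (\<lambda>Q. Q \<in> ?R) ?Q"
        using Q less unfolding is_arg_max_def by (metis less_asym less_irrefl)
      show "Q' = ?Q" if "is_arg_max f (\<lambda>Q. Q \<in> ?R) Q'" for Q'
        using that Q less unfolding is_arg_max_def by blast
    qed
    with False show ?thesis unfolding chosen_range_def f_def by simp
  qed
qed

lemma chord_starts_uminus: "a + v \<in> chord_starts K (- v) \<longleftrightarrow> a \<in> chord_starts K v"
  by (auto simp: chord_starts_def)

text \<open>
  The chord of the range is lowest or highest among its parallel companions. Exchanging \<open>p\<close> and \<open>q\<close>
  reverses the chord vector, hence turns heights upside down and makes the highest chord the lowest.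
\<close>

lemma range_chosen_for_some_order:
  assumes K: "convex_body K" "strictly_convex K" and "p \<noteq> q"
    and p: "p - x \<in> frontier K" and q: "q - x \<in> frontier K"
  shows "chosen_range (interior K) p q = (+) x ` interior K \<or>
         chosen_range (interior K) q p = (+) x ` interior K"
proof -
  define v where "v = q - p"
  have v: "v \<noteq> 0" using assms(3) by (simp add: v_def)
  have cK: "closed K" using K by (auto simp: convex_body_def compact_imp_closed)
  have x: "p - x \<in> chord_starts K v"
    using p q by (simp add: chord_starts_def v_def)
  consider "\<forall>b\<in>chord_starts K v. b \<noteq> p - x \<longrightarrow> perp v \<bullet> (p - x) < perp v \<bullet> b"
    | "\<forall>b\<in>chord_starts K v. b \<noteq> p - x \<longrightarrow> perp v \<bullet> b < perp v \<bullet> (p - x)"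
    using no_chord_between_chords[OF K(2) cK v _ x] chord_heights_distinct[OF K(2) cK v x]
    by (metis linorder_neqE_linordered_idom)
  then show ?thesis
  proof cases
    case 1
    then show ?thesis using chosen_range_eqI[OF K, of p x q] x by (auto simp: v_def)
  next
    case 2
    have "chosen_range (interior K) q p = (+) x ` interior K"
    proof (rule chosen_range_eqI[OF K])
      have vm: "p - q = - v" by (simp add: v_def)
      show "q - x \<in> chord_starts K (p - q)"
        using x chord_starts_uminus[of "p - x" v K] by (simp add: vm) (simp add: v_def)
      fix b assume b: "b \<in> chord_starts K (p - q)" "b \<noteq> q - x"
      have "b - v \<in> chord_starts K v"
        using b(1) chord_starts_uminus[of "b - v" v K] by (simp add: vm)
      moreover have "b - v \<noteq> p - x" using b(2) by (auto simp: v_def algebra_simps)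
      ultimately have "perp v \<bullet> (b - v) < perp v \<bullet> (p - x)" using 2 by blast
      moreover have "q - x = (p - x) + v" by (simp add: v_def)
      ultimately show "perp (p - q) \<bullet> (q - x) < perp (p - q) \<bullet> b"
        by (simp add: vm perp_uminus inner_add_right inner_diff_right)
    qed
    then show ?thesis ..
  qed
qed

section \<open>Charging sets to edges\<close>

lemma finite_k_edges: "finite S \<Longrightarrow> finite (k_edges C k S)"
  by (rule finite_subset[of _ "S \<times> S"]) (auto simp: k_edges_def)

text \<open>
  General position guarantees that the two points found on the boundary are the only ones. All other
  points of \<open>S\<close> are then strictly inside or strictly outside, according to whether they are in \<open>T\<close>.
\<close>

lemma k_set_near_edge:
  assumes K: "convex_body K" "strictly_convex K"
    and S: "finite S" "general_position (interior K) S" and "k \<ge> 2"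
    and T: "T \<in> k_sets (interior K) k S"
  obtains p q where
    "(p, q) \<in> k_edges (interior K) (k - 2) S \<union> k_edges (interior K) (k - 1) S
            \<union> k_edges (interior K) k S"
    "T - {p, q} = S \<inter> chosen_range (interior K) p q"
proof -
  let ?C = "interior K"
  have cK: "closed K" using K by (auto simp: convex_body_def compact_imp_closed)
  obtain x0 where TS: "T \<subseteq> S" and card: "card T = k" and x0: "T = S \<inter> (+) x0 ` ?C"
    using T by (auto simp: k_sets_def translates_def)
  have in0: "t - x0 \<in> K" if "t \<in> T" for t
    using that x0 interior_subset[of K] by (auto simp: mem_translation_iff)
  have out0: "s - x0 \<notin> ?C" if "s \<in> S - T" for s
    using that x0 by (auto simp: mem_translation_iff)
  have ge2: "2 \<le> DIM(real^2)" "card T \<ge> 2" using card \<open>k \<ge> 2\<close> by simp_all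
  obtain p q x where pq: "p \<in> S" "q \<in> S" "p \<noteq> q" "p - x \<in> frontier K" "q - x \<in> frontier K"
    and xin: "\<forall>t\<in>T. t - x \<in> K" and xout: "\<forall>s\<in>S - T. s - x \<notin> ?C"
    by (rule exists_two_frontier_points[OF K(1) ge2(1) S(1) TS ge2(2) in0 out0])
  let ?Q = "(+) x ` ?C"
  have only: "s = p \<or> s = q" if "s \<in> S" "s - x \<in> frontier K" for s
  proof (rule ccontr)
    assume s: "\<not> (s = p \<or> s = q)"
    have "?Q \<in> translates ?C" by (auto simp: translates_def)
    moreover have "p \<in> frontier ?Q" "q \<in> frontier ?Q" "s \<in> frontier ?Q"
      using pq(4,5) that(2) by (simp_all only: mem_frontier_translation_iff[OF K(1)])
    ultimately show False
      using S(2) pq(1-3) that(1) s unfolding general_position_def by metis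
  qed
  note split = closed_mem_iff_interior_or_frontier[OF cK] interior_not_frontier[of _ K]
  have rest: "T - {p, q} = S \<inter> ?Q"
  proof (intro equalityI subsetI)
    fix s assume s: "s \<in> T - {p, q}"
    with TS have "s \<in> S" by auto
    with s only[of s] have "s - x \<notin> frontier K" by auto
    with s xin split(1)[of "s - x"] \<open>s \<in> S\<close> show "s \<in> S \<inter> ?Q"
      unfolding mem_translation_iff Int_iff by auto
  next
    fix s assume s: "s \<in> S \<inter> ?Q"
    then have "s - x \<in> ?C" unfolding mem_translation_iff Int_iff by auto
    with s xout pq(4,5) split(2)[of "s - x"] show "s \<in> T - {p, q}"
      by auto
  qed
  have "card (T - {p, q}) = k - card (T \<inter> {p, q})"
    using card S(1) TS by (simp add: card_Diff_subset_Int finite_subset)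
  moreover have "card (T \<inter> {p, q}) \<le> 2"
    using card_mono[of "{p, q}" "T \<inter> {p, q}"] by (simp add: pq(3))
  ultimately have cards: "card (S \<inter> ?Q) \<in> {k - 2, k - 1, k}"
    unfolding rest insert_iff empty_iff by presburger
  have thr: "?Q \<in> ranges_through ?C p q" "?Q \<in> ranges_through ?C q p"
    using pq(4,5) by (auto simp: ranges_through_def translates_def mem_frontier_translation_iff[OF K(1)])
  from range_chosen_for_some_order[OF K pq(3-5)] show thesis
  proof
    assume "chosen_range ?C p q = ?Q"
    then show thesis
      using that[of p q] rest cards pq(1-3) thr(1) by (auto simp: k_edges_def cocircular_pairs_def)
  next
    assume "chosen_range ?C q p = ?Q"
    then show thesis
      using that[of q p] rest cards pq(1-3) thr(2)
      by (auto simp: k_edges_def cocircular_pairs_def insert_commute)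
  qed
qed

theorem lemma4p6:
  fixes K C S :: "(real^2) set" and k :: nat
  assumes "convex_body K" and "strictly_convex K" and "C = interior K"
    and "finite S" and "general_position C S"
    and "k \<ge> 2"
  shows "card (k_sets C k S) \<le>
           4 * (card (k_edges C (k - 2) S) + card (k_edges C (k - 1) S) + card (k_edges C k S))"
proof -
  let ?E = "k_edges C (k - 2) S \<union> k_edges C (k - 1) S \<union> k_edges C k S"
  \<comment> \<open>A \<open>k\<close>-set is recovered from an edge near it and from two bits telling which end points of the
    edge it contains; the bits are the source of the factor 4.\<close>
  let ?code = "\<lambda>((p, q), i, j). (S \<inter> chosen_range C p q) \<union> (if i then {p} else {}) \<union> (if j then {q} else {})"
  have finE: "finite ?E" using assms(4) by (simp add: finite_k_edges)
  have "k_sets C k S \<subseteq> ?code ` (?E \<times> (UNIV :: (bool \<times> bool) set))"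
  proof
    fix T assume "T \<in> k_sets C k S"
    then obtain p q where e: "(p, q) \<in> ?E" and rest: "T - {p, q} = S \<inter> chosen_range C p q"
      using k_set_near_edge[OF assms(1,2,4) _ assms(6), of T] assms(3,5) by metis
    have "T = (T - {p, q}) \<union> (if p \<in> T then {p} else {}) \<union> (if q \<in> T then {q} else {})"
      by auto
    then have "T = ?code ((p, q), p \<in> T, q \<in> T)"
      unfolding rest prod.case .
    moreover have "((p, q), p \<in> T, q \<in> T) \<in> ?E \<times> UNIV"
      using e by blast
    ultimately show "T \<in> ?code ` (?E \<times> UNIV)"
      by (rule image_eqI)
  qed
  then have "card (k_sets C k S) \<le> card (?E \<times> (UNIV :: (bool \<times> bool) set))"
    by (rule surj_card_le[OF finite_cartesian_product[OF finE finite]])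
  also have "\<dots> = 4 * card ?E"
    by (simp only: card_cartesian_product card_prod card_UNIV_bool)
  also have "card ?E \<le> card (k_edges C (k - 2) S) + card (k_edges C (k - 1) S) + card (k_edges C k S)"
    by (meson card_Un_le add_mono le_trans order_refl)
  finally show ?thesis by simp
qed

end
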